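(* Let $X$ be a hereditarily Baire topological space, let $Y$ be a metric space, and let $f:X\to Y$ be a Baire-one function. Suppose that at least one of the following conditions holds: (1) $X$ is a connected and locally connected space and $f$ is weakly Gibson on $X$; (2) $X$ is an arcwise connected space and $f$ is a Darboux function; (3) $X$ is a topological vector space and $f$ is segmentary connected. Then $f$ has a connected graph.
   Context: A topological space is hereditarily Baire if every closed subset of it is a Baire space. A function $f:X\to Y$ is Baire-one if there is a sequence of continuous functions $f_n:X\to Y$ with $\lim_{n\to\infty} f_n(x)=f(x)$ for every $x\in X$. $f$ is weakly Gibson on $X$ if for every $x\in X$ and every open connected set $G\subseteq X$ with $x\in\overline{G}$ one has $f(x)\in\overline{f(G)}$. $f$ is a Darboux function if $f(C)$ is connected for every connected $C\subseteq X$. For a topological vector space $X$, $f$ is segmentary connected if $f([a,b])$ is connected for every segment $[a,b]=\{(1-t)a+tb:t\in[0,1]\}$, $a,b\in X$. $X$ is arcwise connected if for any two distinct points $x_0,x\in X$ there is a homeomorphic embedding $h:[0,1]\to X$ with $h(0)=x_0$ and $h(1)=x$. $f$ has a connected graph if $\{(x,f(x)):x\in X\}$ is a connected subset of $X\times Y$. *)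

theory Defs
  imports "HOL-Algebra.Module" "HOL-Analysis.Analysis"
begin

section \<open>Baire spaces\<close>

definition Baire_space :: "'a topology \<Rightarrow> bool" where
  "Baire_space X \<longleftrightarrow>
    (\<forall>U :: nat \<Rightarrow> 'a set.
      (\<forall>n. openin X (U n) \<and> X closure_of (U n) = topspace X) \<longrightarrow>
      X closure_of (\<Inter>n. U n) = topspace X)"

text \<open>Only closed subsets are considered here; the library's \<open>hereditarily\<close> ranges over all subsets.\<close>

definition hereditarily_Baire_space :: "'a topology \<Rightarrow> bool" where
  "hereditarily_Baire_space X \<longleftrightarrow> (\<forall>F. closedin X F \<longrightarrow> Baire_space (subtopology X F))"

section \<open>Classes of functions between topological spaces\<close>

text \<open>In these definitions a function \<open>X \<rightarrow> Y\<close> is a HOL function whose values outside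
  \<open>topspace X\<close> are irrelevant; that it maps \<open>topspace X\<close> into \<open>topspace Y\<close>
  is to be assumed separately.\<close>

definition Baire_one_map :: "'a topology \<Rightarrow> 'b topology \<Rightarrow> ('a \<Rightarrow> 'b) \<Rightarrow> bool" where
  "Baire_one_map X Y f \<longleftrightarrow>
    (\<exists>F :: nat \<Rightarrow> 'a \<Rightarrow> 'b.
      (\<forall>n. continuous_map X Y (F n)) \<and>
      (\<forall>x \<in> topspace X. limitin Y (\<lambda>n. F n x) (f x) sequentially))"

definition weakly_Gibson_map :: "'a topology \<Rightarrow> 'b topology \<Rightarrow> ('a \<Rightarrow> 'b) \<Rightarrow> bool" where
  "weakly_Gibson_map X Y f \<longleftrightarrow>
    (\<forall>x \<in> topspace X. \<forall>G.
      openin X G \<and> connectedin X G \<and> x \<in> X closure_of G \<longrightarrow> f x \<in> Y closure_of (f ` G))"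

definition Darboux_map :: "'a topology \<Rightarrow> 'b topology \<Rightarrow> ('a \<Rightarrow> 'b) \<Rightarrow> bool" where
  "Darboux_map X Y f \<longleftrightarrow> (\<forall>C. connectedin X C \<longrightarrow> connectedin Y (f ` C))"

definition has_connected_graph :: "'a topology \<Rightarrow> 'b topology \<Rightarrow> ('a \<Rightarrow> 'b) \<Rightarrow> bool" where
  "has_connected_graph X Y f \<longleftrightarrow>
    connectedin (prod_topology X Y) {(x, f x) | x. x \<in> topspace X}"

section \<open>Arcwise connected spaces\<close>

definition arcwise_connected_space :: "'a topology \<Rightarrow> bool" where
  "arcwise_connected_space X \<longleftrightarrow>
    (\<forall>x0 \<in> topspace X. \<forall>x \<in> topspace X. x0 \<noteq> x \<longrightarrow>
      (\<exists>h :: real \<Rightarrow> 'a. embedding_map (top_of_set {0..1}) X h \<and> h 0 = x0 \<and> h 1 = x))"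

section \<open>Topological vector spaces\<close>

definition real_field :: "real ring" where
  "real_field = \<lparr>carrier = UNIV, monoid.mult = (*), one = 1, ring.zero = 0, ring.add = (+)\<rparr>"

lemma field_real_field: "field real_field"
proof (rule cring.cring_fieldI)
  show "cring real_field"
  proof (rule cringI)
    show "abelian_group real_field"
    proof (rule abelian_groupI)
      fix x :: real
      show "\<exists>y\<in>carrier real_field. y \<oplus>\<^bsub>real_field\<^esub> x = \<zero>\<^bsub>real_field\<^esub>"
        by (rule bexI[of _ "- x"]) (auto simp: real_field_def)
    qed (auto simp: real_field_def)
    show "comm_monoid real_field"
      by (rule comm_monoidI) (auto simp: real_field_def)
  qed (auto simp: real_field_def algebra_simps)
  show "Units real_field = carrier real_field - {\<zero>\<^bsub>real_field\<^esub>}"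
  proof -
    have "\<exists>y. y * x = 1 \<and> x * y = 1" if "x \<noteq> 0" for x :: real
      using that by (intro exI[of _ "inverse x"]) simp
    then show ?thesis
      by (auto simp: Units_def real_field_def)
  qed
qed

text \<open>A real vector space is a module over \<open>real_field\<close>. The multiplicative fields \<open>mult\<close> and
  \<open>one\<close> that the record type inherits from rings are irrelevant for \<open>V\<close>. No separation axiom
  is imposed.\<close>

definition topological_vector_space :: "'a topology \<Rightarrow> (real, 'a) module \<Rightarrow> bool" where
  "topological_vector_space X V \<longleftrightarrow>
    Module.module real_field V \<and> carrier V = topspace X \<and>
    continuous_map (prod_topology X X) X (\<lambda>(x, y). x \<oplus>\<^bsub>V\<^esub> y) \<and>
    continuous_map (prod_topology euclideanreal X) X (\<lambda>(t, x). t \<odot>\<^bsub>V\<^esub> x)"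

definition segment :: "(real, 'a) module \<Rightarrow> 'a \<Rightarrow> 'a \<Rightarrow> 'a set" where
  "segment V a b = {((1 - t) \<odot>\<^bsub>V\<^esub> a) \<oplus>\<^bsub>V\<^esub> (t \<odot>\<^bsub>V\<^esub> b) | t. t \<in> {0..1}}"

definition segmentary_connected_map ::
    "(real, 'a) module \<Rightarrow> 'b topology \<Rightarrow> ('a \<Rightarrow> 'b) \<Rightarrow> bool" where
  "segmentary_connected_map V Y f \<longleftrightarrow>
    (\<forall>a \<in> carrier V. \<forall>b \<in> carrier V. connectedin Y (f ` segment V a b))"

end

theory Submission
  imports Defs
begin

text \<open>A partition of the graph into two relatively open sets splits \<open>X\<close> into \<open>A\<close> and its
  complement. If \<open>X\<close> is connected then the frontier of \<open>A\<close> is nonempty, and since it is a Baire space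
  the restriction of \<open>f\<close> to it has a point of continuity \<open>x\<^sub>0\<close>, say in \<open>A\<close>. Near \<open>x\<^sub>0\<close> the frontier
  then lies in \<open>A\<close>, so in a small connected neighbourhood of \<open>x\<^sub>0\<close> the complement of \<open>A\<close> is open.
  One of its components accumulates at a point of the frontier, where \<open>f\<close> takes a value close to
  \<open>f x\<^sub>0\<close>, and the weak Gibson property produces such values on the component itself, which contradicts the
  openness of the part of the graph over \<open>A\<close>.

  In the other two cases any two points are joined by a path along which \<open>f\<close> maps intervals to
  connected sets; the composition with the path is weakly Gibson on \<open>[0, 1]\<close>, so the first case
  applies to it.\<close>

section \<open>Points of continuity of Baire-one maps\<close>

text \<open>The union is the complement of the boundary of \<open>C\<close>, and a closed set has
  nowhere dense boundary: an open set that misses \<open>topspace Z - C\<close> lies in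
  \<open>C\<close>, hence in its interior.\<close>

lemma openin_dense_interior_Un_complement:
  assumes "closedin Z C"
  shows "openin Z (Z interior_of C \<union> (topspace Z - C))"
    and "Z closure_of (Z interior_of C \<union> (topspace Z - C)) = topspace Z"
proof -
  show "openin Z (Z interior_of C \<union> (topspace Z - C))"
    using assms by (intro openin_Un openin_interior_of openin_diff openin_topspace)
  have "(Z interior_of C \<union> (topspace Z - C)) \<inter> T \<noteq> {}" if "openin Z T" "T \<noteq> {}" for T
    using that interior_of_maximal[of T C Z] openin_subset[of Z T] by blast
  then show "Z closure_of (Z interior_of C \<union> (topspace Z - C)) = topspace Z"
    unfolding dense_intersects_open by blast
qed

text \<open>By the Baire property some point avoids the boundaries of all the countably many sets
  \<open>C n k\<close> at once.\<close>

lemma Baire_space_obtain_interior_point: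
  fixes C :: "nat \<Rightarrow> nat \<Rightarrow> 'a set"
  assumes "Baire_space Z" "topspace Z \<noteq> {}"
    and closed: "\<And>n k. closedin Z (C n k)"
  obtains x where "x \<in> topspace Z" "\<And>n k. x \<in> C n k \<Longrightarrow> x \<in> Z interior_of (C n k)"
proof -
  define D where "D n k = Z interior_of (C n k) \<union> (topspace Z - C n k)" for n k
  \<comment> \<open>\<open>Baire_space\<close> speaks of a single sequence, so the pairs of indices
    are enumerated.\<close>
  define U where "U i = (case prod_decode i of (n, k) \<Rightarrow> D n k)" for i
  have "openin Z (U i) \<and> Z closure_of (U i) = topspace Z" for i
    using openin_dense_interior_Un_complement[OF closed] by (auto simp: U_def D_def split: prod.split)
  with assms(1) have "Z closure_of (\<Inter>i. U i) = topspace Z"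
    unfolding Baire_space_def by blast
  with assms(2) obtain x where x: "x \<in> (\<Inter>i. U i)" "x \<in> topspace Z"
    by (metis closure_of_eq_empty_gen disjnt_def disjoint_iff)
  have "x \<in> D n k" for n k
    using x(1) by (auto simp: U_def dest: spec[of _ "prod_encode (n, k)"])
  with x(2) show thesis
    using that unfolding D_def by blast
qed

text \<open>Let \<open>C n k\<close> consist of the points where \<open>F n\<close> stays within
  \<open>e k\<close> of all later terms. At a point that is interior to every \<open>C n k\<close>
  containing it, \<open>f\<close> is near a continuous \<open>F n\<close> on a whole neighbourhood,
  for each tolerance \<open>e k\<close>.\<close>

lemma Baire_one_map_topcontinuous_at:
  assumes "Metric_space M d" "Baire_space Z" "topspace Z \<noteq> {}"
    and f: "Baire_one_map Z (Metric_space.mtopology M d) f"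
  obtains x where "topcontinuous_at Z (Metric_space.mtopology M d) f x"
proof -
  interpret Metric_space M d by fact
  obtain F where F: "\<And>n. continuous_map Z mtopology (F n)"
    and lim: "\<And>x. x \<in> topspace Z \<Longrightarrow> limitin mtopology (\<lambda>n. F n x) (f x) sequentially"
    using f unfolding Baire_one_map_def by blast
  have FM: "F n x \<in> M" if "x \<in> topspace Z" for n x
    using F[of n] that by (auto simp: continuous_map_def)
  have fM: "f x \<in> M" if "x \<in> topspace Z" for x
    using lim[OF that] by (simp add: limitin_metric)
  have ev: "eventually (\<lambda>n. d (F n x) (f x) < e) sequentially" if "x \<in> topspace Z" "e > 0" for x e
    using lim[OF that(1)] that(2) by (auto simp: limitin_metric elim: eventually_mono)
  define e where "e k = inverse (real (Suc k))" for k
  have e_pos: "e k > 0" for k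
    by (simp add: e_def)
  \<comment> \<open>Comparing \<open>F n\<close> with the terms \<open>F m\<close> rather than with
    \<open>f\<close> makes \<open>C n k\<close> closed, being an intersection of preimages of closed
    sets under continuous maps.\<close>
  define C where "C n k = {x \<in> topspace Z. \<forall>m\<ge>n. d (F n x) (F m x) \<le> e k}" for n k
  have closed_C: "closedin Z (C n k)" for n k
  proof -
    have "closedin Z {x \<in> topspace Z. d (F n x) (F m x) \<in> {..e k}}" for m
    proof (rule closedin_continuous_map_preimage)
      show "continuous_map Z euclideanreal (\<lambda>x. d (F n x) (F m x))"
        using continuous_map_mdist[of Z Self "F n" "F m"] F by (simp add: mtopology_of_def)
    qed simp
    moreover have "C n k = (\<Inter>m\<in>{n..}. {x \<in> topspace Z. d (F n x) (F m x) \<in> {..e k}})"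
      by (auto simp: C_def)
    ultimately show ?thesis
      by (metis (no_types, lifting) closedin_INT atLeast_iff empty_iff order_refl)
  qed
  obtain x where x: "x \<in> topspace Z"
    and int: "\<And>n k. x \<in> C n k \<Longrightarrow> x \<in> Z interior_of (C n k)"
    using Baire_space_obtain_interior_point[of Z C, OF assms(2,3) closed_C] by metis
  have "\<exists>U. openin Z U \<and> x \<in> U \<and> (\<forall>y\<in>U. f y \<in> V)" if V: "openin mtopology V" "f x \<in> V" for V
  proof -
    obtain r where r: "r > 0" "mball (f x) r \<subseteq> V"
      using V by (auto simp: openin_mtopology)
    \<comment> \<open>The distance from \<open>f x\<close> to \<open>f y\<close> is going to be
      split into four distances, each at most \<open>e k\<close>.\<close>
    obtain k where k: "e k < r / 4"
      using reals_Archimedean[of "r / 4"] r(1) by (auto simp: e_def)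
    \<comment> \<open>Two distances below \<open>e k / 2\<close>, through \<open>f x\<close>, bound
      the distance between \<open>F n x\<close> and \<open>F m x\<close> and so place
      \<open>x\<close> in \<open>C n k\<close>.\<close>
    obtain n where n: "\<And>m. m \<ge> n \<Longrightarrow> d (F m x) (f x) < e k / 2"
      using ev[OF x, of "e k / 2"] e_pos[of k] by (auto simp: eventually_sequentially)
    have "d (F n x) (F m x) \<le> e k" if "m \<ge> n" for m
      using triangle[of "F n x" "f x" "F m x"] commute[of "f x" "F m x"] n[of n] n[OF that]
        FM[OF x] fM[OF x] by simp
    then have "x \<in> C n k"
      using x by (simp add: C_def)
    then have xint: "x \<in> Z interior_of (C n k)"
      by (rule int)
    define U where "U = {y \<in> topspace Z. F n y \<in> mball (F n x) (e k)} \<inter> Z interior_of (C n k)"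
    have "openin Z U"
      unfolding U_def using F[of n] by (intro openin_Int openin_continuous_map_preimage) auto
    moreover have "x \<in> U"
      using x xint FM e_pos by (auto simp: U_def)
    moreover have "f y \<in> V" if "y \<in> U" for y
    proof -
      have y: "y \<in> topspace Z" "d (F n x) (F n y) < e k" "y \<in> C n k"
        using that interior_of_subset[of Z "C n k"] by (auto simp: U_def)
      \<comment> \<open>The index \<open>m\<close> depends on \<open>y\<close>, but the bound
        between \<open>F n y\<close> and \<open>F m y\<close> is uniform because \<open>y\<close>
        lies in \<open>C n k\<close>.\<close>
      obtain m where m: "m \<ge> n" "d (F m y) (f y) < e k"
        using ev[OF y(1) e_pos[of k]] unfolding eventually_sequentially by (meson nle_le)
      have "d (f x) (f y) \<le> d (f x) (F n x) + d (F n x) (F n y) + d (F n y) (F m y) + d (F m y) (f y)"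
        using triangle[of "f x" "F n x" "f y"] triangle[of "F n x" "F n y" "f y"]
          triangle[of "F n y" "F m y" "f y"] FM x y(1) fM by fastforce
      moreover have "d (f x) (F n x) < e k"
        using n[of n] e_pos[of k] commute[of "f x"] by simp
      moreover have "d (F n y) (F m y) \<le> e k"
        using y(3) m(1) by (simp add: C_def)
      ultimately have "d (f x) (f y) < r"
        using y(2) m(2) k by linarith
      then show ?thesis
        using r(2) fM x y(1) by auto
    qed
    ultimately show ?thesis
      by blast
  qed
  then have "topcontinuous_at Z mtopology f x"
    using x fM by (auto simp: topcontinuous_at_def)
  then show thesis
    by (rule that)
qed

section \<open>Stability of Baire-one maps, and completely metrizable spaces\<close>

lemma Baire_one_map_compose:
  assumes "continuous_map Z X h" "Baire_one_map X Y f"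
  shows "Baire_one_map Z Y (f \<circ> h)"
proof -
  obtain F where F: "\<And>n. continuous_map X Y (F n)"
    and lim: "\<And>x. x \<in> topspace X \<Longrightarrow> limitin Y (\<lambda>n. F n x) (f x) sequentially"
    using assms(2) unfolding Baire_one_map_def by blast
  have "h z \<in> topspace X" if "z \<in> topspace Z" for z
    using assms(1) that by (auto simp: continuous_map_def)
  then show ?thesis
    unfolding Baire_one_map_def
    using continuous_map_compose[OF assms(1) F] lim by (intro exI[of _ "\<lambda>n. F n \<circ> h"]) auto
qed

lemma Baire_one_map_subtopology:
  "Baire_one_map X Y f \<Longrightarrow> Baire_one_map (subtopology X S) Y f"
  using Baire_one_map_compose[of "subtopology X S" X id Y f] continuous_map_from_subtopology[of X X id S]
  by simp

lemma graph_subset_topspace_prod: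
  assumes "Baire_one_map X Y f"
  shows "(\<lambda>x. (x, f x)) ` topspace X \<subseteq> topspace (prod_topology X Y)"
proof -
  have "f x \<in> topspace Y" if "x \<in> topspace X" for x
    using assms that limitin_topspace unfolding Baire_one_map_def by metis
  then show ?thesis
    by auto
qed

lemma completely_metrizable_imp_Baire_space:
  fixes X :: "'a topology"
  assumes "completely_metrizable_space X"
  shows "Baire_space X"
  unfolding Baire_space_def
proof (intro allI impI)
  fix U :: "nat \<Rightarrow> 'a set"
  assume "\<forall>n. openin X (U n) \<and> X closure_of (U n) = topspace X"
  then show "X closure_of (\<Inter>n. U n) = topspace X"
    using assms by (intro Baire_category) auto
qed

text \<open>This supplies the Baire hypothesis on the parameter interval of a path.\<close>

lemma completely_metrizable_imp_hereditarily_Baire_space: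
  "completely_metrizable_space X \<Longrightarrow> hereditarily_Baire_space X"
  by (simp add: hereditarily_Baire_space_def completely_metrizable_imp_Baire_space
      completely_metrizable_space_closedin)

section \<open>Weakly Gibson maps on locally connected spaces\<close>

text \<open>Assumption \<open>WN\<close> carries the openness of the graph over \<open>A\<close>:
  the box \<open>W \<times> N\<close> meets the graph only over \<open>A\<close>. Naming just one of
  the two sides lets the lemma serve both \<open>A\<close> and its complement.\<close>

lemma weakly_Gibson_frontier_contradiction:
  assumes lc: "locally_connected_space X" and wG: "weakly_Gibson_map X Y f"
    and x0: "x\<^sub>0 \<in> A" and cont: "topcontinuous_at (subtopology X (X frontier_of A)) Y f x\<^sub>0"
    and W: "openin X W" "x\<^sub>0 \<in> W" and N: "openin Y N" "f x\<^sub>0 \<in> N"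
    and WN: "\<And>x. x \<in> W \<Longrightarrow> f x \<in> N \<Longrightarrow> x \<in> A"
  shows False
proof -
  define B where "B = topspace X - A"
  have x0F: "x\<^sub>0 \<in> X frontier_of A"
    using cont by (simp add: topcontinuous_at_def)
  obtain U' where U': "openin (subtopology X (X frontier_of A)) U'" "x\<^sub>0 \<in> U'" "\<forall>x\<in>U'. f x \<in> N"
    using cont N unfolding topcontinuous_at_def by blast
  then obtain U where U: "openin X U" "U' = U \<inter> X frontier_of A"
    by (auto simp: openin_subtopology)
  obtain W' where W': "openin X W'" "connectedin X W'" "x\<^sub>0 \<in> W'" "W' \<subseteq> U \<inter> W"
    using lc U U'(2) W unfolding locally_connected_space by (metis IntE IntI openin_Int)
  have frontier: "f x \<in> N" "x \<in> A" if "x \<in> W'" "x \<in> X frontier_of A" for x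
    using that W'(4) U(2) U'(3) WN by blast+
  define V where "V = W' \<inter> B"
  \<comment> \<open>A point of \<open>W'\<close> in \<open>B\<close> is off the boundary, which
    \<open>A\<close> and \<open>B\<close> share, so it is interior to \<open>B\<close>.\<close>
  have V: "V = W' \<inter> X interior_of B"
  proof -
    have "x \<in> X interior_of B" if "x \<in> W'" "x \<in> B" for x
    proof -
      have "x \<notin> X frontier_of B"
        using frontier that frontier_of_complement[of X A] by (auto simp: B_def)
      then show ?thesis
        using closure_of_subset[of B X] that by (auto simp: frontier_of_def B_def)
    qed
    then show ?thesis
      using interior_of_subset[of X B] by (auto simp: V_def)
  qed
  have "openin X V"
    unfolding V using W'(1) by (simp add: openin_Int)
  have "x\<^sub>0 \<in> X closure_of B"
    using x0F frontier_of_closures[of X A] by (auto simp: B_def)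
  then obtain y where y: "y \<in> V"
    using W'(1,3) by (auto simp: in_closure_of V_def)
  \<comment> \<open>Local connectedness makes the components of the open set \<open>V\<close> open,
    so the weak Gibson property is applicable to \<open>G\<close>.\<close>
  define G where "G = connected_component_of_set (subtopology X V) y"
  have G: "openin X G" "connectedin X G" "G \<subseteq> V" "y \<in> G"
  proof -
    show "openin X G"
      using lc \<open>openin X V\<close> y unfolding G_def locally_connected_space_eq_open_connected_component_of
      by blast
    have "connectedin (subtopology X V) G"
      unfolding G_def by (rule connectedin_connected_component_of)
    then show "connectedin X G" "G \<subseteq> V"
      by (auto simp: connectedin_subtopology)
    show "y \<in> G"
      using y openin_subset[OF \<open>openin X V\<close>] by (auto simp: G_def connected_component_of_refl)
  qed
  have "x\<^sub>0 \<notin> G"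
    using G(3) x0 by (auto simp: V_def B_def)
  \<comment> \<open>The connected set \<open>W'\<close> contains \<open>y\<close> in
    \<open>G\<close> and \<open>x\<^sub>0\<close> outside \<open>G\<close>, so it cannot miss the
    boundary of \<open>G\<close>.\<close>
  then have "W' \<inter> X frontier_of G \<noteq> {}"
    using connectedin_Int_frontier_of[OF W'(2), of G] W'(3) G(3,4) y V_def by blast
  then obtain x where x: "x \<in> W'" "x \<in> X closure_of G" "x \<notin> G"
    using frontier_of_openin[OF G(1)] by blast
  \<comment> \<open>Otherwise adding the closure point \<open>x\<close> to \<open>G\<close> would
    give a larger connected subset of \<open>V\<close>, against the maximality of a
    component.\<close>
  have "x \<notin> B"
  proof
    assume "x \<in> B"
    then have "insert x G \<subseteq> V"
      using x(1) G(3) by (auto simp: V_def)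
    moreover have "connectedin X (insert x G)"
      using G(2) by (rule connectedin_intermediate_closure_of)
        (use x(2) closure_of_subset[OF openin_subset[OF G(1)]] in auto)
    ultimately have "insert x G \<subseteq> G"
      unfolding G_def using y G(4)
      by (intro connected_component_of_maximal) (auto simp: connectedin_subtopology G_def)
    with x(3) show False
      by blast
  qed
  have xX: "x \<in> topspace X"
    using x(2) by (simp add: in_closure_of)
  with \<open>x \<notin> B\<close> have "x \<in> A"
    by (simp add: B_def)
  moreover have "x \<in> X closure_of B"
    using x(2) closure_of_mono[of G B X] G(3) by (auto simp: V_def)
  ultimately have "x \<in> X frontier_of A"
    using xX unfolding frontier_of_closures B_def
    by (metis IntI closure_of_subset_Int Int_iff subsetD)
  then have "f x \<in> N"
    using frontier x(1) by blast
  \<comment> \<open>Hence \<open>f\<close> takes a value in \<open>N\<close> at some point of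
    \<open>G\<close>. By \<open>WN\<close> that point is in \<open>A\<close>, whereas
    \<open>G\<close> is contained in \<open>B\<close>.\<close>
  moreover have "f x \<in> Y closure_of (f ` G)"
    using wG xX G(1,2) x(2) unfolding weakly_Gibson_map_def by blast
  ultimately obtain z where "z \<in> G" "f z \<in> N"
    using N(1) by (auto simp: in_closure_of)
  then show False
    using WN[of z] G(3) W'(4) by (auto simp: V_def B_def)
qed

lemma weakly_Gibson_Baire_one_connected_graph:
  assumes "hereditarily_Baire_space X" "Metric_space M d"
    and f: "Baire_one_map X (Metric_space.mtopology M d) f"
    and X: "connected_space X" "locally_connected_space X"
    and wG: "weakly_Gibson_map X (Metric_space.mtopology M d) f"
  shows "has_connected_graph X (Metric_space.mtopology M d) f"
proof -
  interpret Metric_space M d by fact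
  let ?\<Gamma> = "{(x, f x) | x. x \<in> topspace X}"
  have "?\<Gamma> \<subseteq> topspace (prod_topology X mtopology)"
    using graph_subset_topspace_prod[OF f] by auto
  moreover have False
    if E: "openin (prod_topology X mtopology) E1" "openin (prod_topology X mtopology) E2"
      "?\<Gamma> \<subseteq> E1 \<union> E2" "E1 \<inter> E2 \<inter> ?\<Gamma> = {}" "E1 \<inter> ?\<Gamma> \<noteq> {}" "E2 \<inter> ?\<Gamma> \<noteq> {}" for E1 E2
  proof -
    define A where "A = {x \<in> topspace X. (x, f x) \<in> E1}"
    have B: "topspace X - A = {x \<in> topspace X. (x, f x) \<in> E2}"
      using E(3,4) by (auto simp: A_def)
    have "topspace X \<inter> A \<noteq> {}" "topspace X - A \<noteq> {}"
      using E(5,6) unfolding B by (auto simp: A_def)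
    then have "X frontier_of A \<noteq> {}"
      using connectedin_Int_frontier_of[of X "topspace X" A] X(1) by (auto simp: connectedin_topspace)
    moreover have "Baire_space (subtopology X (X frontier_of A))"
      using assms(1) by (simp add: hereditarily_Baire_space_def closedin_frontier_of)
    ultimately obtain x0 where cont: "topcontinuous_at (subtopology X (X frontier_of A)) mtopology f x0"
      using Baire_one_map_topcontinuous_at[OF assms(2) _ _ Baire_one_map_subtopology[OF f]]
        frontier_of_subset_topspace[of X A] by (metis inf.absorb2 topspace_subtopology)
    \<comment> \<open>The continuity point may lie in \<open>A\<close> or in its complement. Both
      have the same boundary and a relatively open graph part, so one argument is set up for
      either.\<close>
    have *: False if S: "openin (prod_topology X mtopology) E" "x0 \<in> S" "S = {x \<in> topspace X. (x, f x) \<in> E}"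
      "X frontier_of S = X frontier_of A" for E S
    proof -
      obtain W N where "openin X W" "openin mtopology N" "x0 \<in> W" "f x0 \<in> N" "W \<times> N \<subseteq> E"
      proof -
        have "(x0, f x0) \<in> E"
          using S(2,3) by simp
        with S(1) show thesis
          using that unfolding openin_prod_topology_alt by blast
      qed
      then show False
        using weakly_Gibson_frontier_contradiction[OF X(2) wG S(2), of W N] cont S(3,4)
          openin_subset[of X W] by auto
    qed
    have "x0 \<in> topspace X"
      using cont by (simp add: topcontinuous_at_def)
    then show False
      using *[OF E(1) _ A_def] *[OF E(2) _ B] frontier_of_complement[of X A] by blast
  qed
  ultimately show ?thesis
    unfolding has_connected_graph_def connectedin by blast
qed

section \<open>Maps along paths\<close>

text \<open>If the conclusion failed, then, points being closed, \<open>{g x}\<close> and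
  \<open>g\<close> G\<open>would be separated sets covering the connected set\<close>g
  \<open>S\<close>, which meets both.\<close>

lemma in_closure_of_connected_image:
  assumes "t1_space Y" "connectedin Y (g ` S)" "g ` G \<subseteq> topspace Y"
    and "x \<in> S" "S \<subseteq> insert x G" "S \<inter> G \<noteq> {}"
  shows "g x \<in> Y closure_of (g ` G)"
proof (rule ccontr)
  assume neg: "g x \<notin> Y closure_of (g ` G)"
  have gG: "g ` G \<subseteq> Y closure_of (g ` G)"
    using assms(3) by (rule closure_of_subset)
  have gx: "g x \<in> topspace Y"
    using assms(2,4) connectedin_subset_topspace by blast
  then have "Y closure_of {g x} = {g x}"
    using assms(1) by (simp add: closure_of_eq t1_space_closedin_singleton)
  then have "separatedin Y {g x} (g ` G)"
    using neg gG gx assms(3) by (auto simp: separatedin_def)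
  moreover have "g ` S \<subseteq> {g x} \<union> g ` G"
    using assms(5) by blast
  ultimately have "g ` S \<subseteq> {g x} \<or> g ` S \<subseteq> g ` G"
    using connectedin_subset_separated_union[OF assms(2)] by blast
  then show False
  proof
    assume "g ` S \<subseteq> {g x}"
    moreover obtain y where "y \<in> S" "y \<in> G"
      using assms(6) by blast
    ultimately have "g x \<in> g ` G"
      by (metis image_eqI image_subset_iff singletonD)
    then show False
      using neg gG by blast
  next
    assume "g ` S \<subseteq> g ` G"
    then show False
      using neg gG assms(4) by blast
  qed
qed

text \<open>\<open>G\<close> has points arbitrarily close to \<open>x\<close>, and it contains the
  interval from any of them to \<open>y\<close>. The end \<open>x\<close> is left out, as it may lie
  outside \<open>G\<close>.\<close>

lemma connected_real_closure_greaterThanAtMost: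
  fixes G :: "real set"
  assumes "connected G" "x \<in> closure G" "y \<in> G"
  shows "{x<..y} \<subseteq> G"
proof
  fix z assume z: "z \<in> {x<..y}"
  then obtain g where "g \<in> G" "dist g x < z - x"
    using assms(2) unfolding closure_approachable by (metis diff_gt_0_iff_gt greaterThanAtMost_iff)
  then have "z \<in> {g..y}"
    using z by (auto simp: dist_real_def)
  then show "z \<in> G"
    using connected_contains_Icc[OF assms(1) \<open>g \<in> G\<close> assms(3)] by blast
qed

lemma connected_real_closure_atLeastLessThan:
  fixes G :: "real set"
  assumes "connected G" "x \<in> closure G" "y \<in> G"
  shows "{y..<x} \<subseteq> G"
proof
  fix z assume z: "z \<in> {y..<x}"
  then obtain g where "g \<in> G" "dist g x < x - z"
    using assms(2) unfolding closure_approachable by (metis diff_gt_0_iff_gt atLeastLessThan_iff)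
  then have "z \<in> {y..g}"
    using z by (auto simp: dist_real_def)
  then show "z \<in> G"
    using connected_contains_Icc[OF assms(1,3) \<open>g \<in> G\<close>] by blast
qed

text \<open>If \<open>x\<close> is in the closure of a connected \<open>G\<close> containing
  \<open>y\<close>, the closed interval between \<open>x\<close> and \<open>y\<close> lies in
  \<open>insert x G\<close>, and its image is connected.\<close>

lemma weakly_Gibson_map_interval:
  fixes g :: "real \<Rightarrow> 'b"
  assumes Y: "t1_space Y" and g: "g ` {a..b} \<subseteq> topspace Y"
    and conn: "\<And>s t. a \<le> s \<Longrightarrow> s \<le> t \<Longrightarrow> t \<le> b \<Longrightarrow> connectedin Y (g ` {s..t})"
  shows "weakly_Gibson_map (top_of_set {a..b}) Y g"
  unfolding weakly_Gibson_map_def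
proof (intro ballI allI impI, elim conjE)
  fix x G
  assume x: "x \<in> topspace (top_of_set {a..b})" and G: "openin (top_of_set {a..b}) G"
    "connectedin (top_of_set {a..b}) G" "x \<in> top_of_set {a..b} closure_of G"
  have Gab: "G \<subseteq> {a..b}"
    using openin_subset[OF G(1)] by simp
  have "connected G"
    using G(2) by (simp add: connectedin_subtopology)
  moreover have "x \<in> closure G"
    using G(3) Gab by (simp add: closure_of_subtopology inf_absorb2)
  moreover obtain y where y: "y \<in> G"
    using G(3) by (metis closure_of_empty empty_iff ex_in_conv)
  ultimately have "{x..y} \<subseteq> insert x G" "{y..x} \<subseteq> insert x G"
    using connected_real_closure_greaterThanAtMost[of G x y]
      connected_real_closure_atLeastLessThan[of G x y] by force+
  moreover have "g ` G \<subseteq> topspace Y"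
    using g Gab by blast
  moreover have "x \<in> {a..b}" "y \<in> {a..b}"
    using x y Gab by auto
  ultimately show "g x \<in> Y closure_of (g ` G)"
    using in_closure_of_connected_image[OF Y conn, of x y G x]
      in_closure_of_connected_image[OF Y conn, of y x G x] y by (cases "x \<le> y") force+
qed

text \<open>The first case gives \<open>f \<circ> h\<close> a connected graph over
  \<open>[0, 1]\<close>, and \<open>(t, y) \<mapsto> (h t, y)\<close> carries it onto the graph of
  \<open>f\<close> over the path. The path is only required to be continuous, which admits constant
  paths and segments.\<close>

lemma connectedin_graph_over_path:
  fixes h :: "real \<Rightarrow> 'a"
  assumes "Metric_space M d"
    and f: "Baire_one_map X (Metric_space.mtopology M d) f"
    and h: "continuous_map (top_of_set {0..1}) X h"
    and conn: "\<And>s t. 0 \<le> s \<Longrightarrow> s \<le> t \<Longrightarrow> t \<le> 1 \<Longrightarrow>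
      connectedin (Metric_space.mtopology M d) (f ` h ` {s..t})"
  shows "connectedin (prod_topology X (Metric_space.mtopology M d)) ((\<lambda>x. (x, f x)) ` h ` {0..1})"
proof -
  interpret Metric_space M d by fact
  let ?I = "top_of_set {0..1::real}"
  have "weakly_Gibson_map ?I mtopology (f \<circ> h)"
  proof (rule weakly_Gibson_map_interval)
    show "t1_space mtopology"
      by (rule Hausdorff_imp_t1_space[OF Hausdorff_space_mtopology])
    show "(f \<circ> h) ` {0..1} \<subseteq> topspace mtopology"
      using connectedin_subset_topspace[OF conn[of 0 1]] by auto
    show "connectedin mtopology ((f \<circ> h) ` {s..t})" if "0 \<le> s" "s \<le> t" "t \<le> 1" for s t
      using conn[OF that] by (simp add: image_comp)
  qed
  moreover have "hereditarily_Baire_space ?I"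
    by (intro completely_metrizable_imp_hereditarily_Baire_space completely_metrizable_space_closedin
        completely_metrizable_space_euclidean) simp
  moreover have "connected_space ?I"
    by (simp add: connected_space_subtopology)
  moreover have "locally_connected_space ?I"
    by (simp add: locally_connected_is_realinterval is_interval_cc)
  ultimately have "has_connected_graph ?I mtopology (f \<circ> h)"
    using assms(1) Baire_one_map_compose[OF h f]
    by (intro weakly_Gibson_Baire_one_connected_graph) auto
  then have "connectedin (prod_topology ?I mtopology) {(t, f (h t)) | t. t \<in> {0..1}}"
    by (simp add: has_connected_graph_def)
  moreover have "continuous_map (prod_topology ?I mtopology) (prod_topology X mtopology)
      (\<lambda>p. (h (fst p), snd p))"
    using continuous_map_compose[OF continuous_map_fst h]
    by (intro continuous_map_pairedI continuous_map_snd) (simp add: o_def)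
  ultimately have "connectedin (prod_topology X mtopology)
      ((\<lambda>p. (h (fst p), snd p)) ` {(t, f (h t)) | t. t \<in> {0..1}})"
    by (rule connectedin_continuous_map_image[rotated])
  moreover have "(\<lambda>p. (h (fst p), snd p)) ` {(t, f (h t)) | t. t \<in> {0..1}} =
      (\<lambda>x. (x, f x)) ` h ` {0..1}"
    by force
  ultimately show ?thesis
    by simp
qed

text \<open>Any two points of the graph lie in a common connected part of it, namely the graph over
  a path joining their first coordinates.\<close>

lemma has_connected_graph_if_paths:
  assumes "Metric_space M d"
    and f: "Baire_one_map X (Metric_space.mtopology M d) f"
    and path: "\<And>a b. a \<in> topspace X \<Longrightarrow> b \<in> topspace X \<Longrightarrow>
      \<exists>h :: real \<Rightarrow> 'a. continuous_map (top_of_set {0..1}) X h \<and> h 0 = a \<and> h 1 = b \<and>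
        (\<forall>s t. 0 \<le> s \<and> s \<le> t \<and> t \<le> 1 \<longrightarrow>
          connectedin (Metric_space.mtopology M d) (f ` h ` {s..t}))"
  shows "has_connected_graph X (Metric_space.mtopology M d) f"
proof -
  interpret Metric_space M d by fact
  let ?\<Gamma> = "(\<lambda>x. (x, f x)) ` topspace X"
  let ?P = "prod_topology X mtopology"
  have \<Gamma>: "?\<Gamma> \<subseteq> topspace ?P"
    using f by (rule graph_subset_topspace_prod)
  have "\<exists>S. connectedin (subtopology ?P ?\<Gamma>) S \<and> (a, f a) \<in> S \<and> (b, f b) \<in> S"
    if "a \<in> topspace X" "b \<in> topspace X" for a b
  proof -
    obtain h where h: "continuous_map (top_of_set {0..1::real}) X h" "h 0 = a" "h 1 = b"
      and conn: "\<And>s t. 0 \<le> s \<and> s \<le> t \<and> t \<le> 1 \<longrightarrow> connectedin mtopology (f ` h ` {s..t})"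
      using path[OF \<open>a \<in> topspace X\<close> \<open>b \<in> topspace X\<close>] by blast
    have "connectedin ?P ((\<lambda>x. (x, f x)) ` h ` {0..1})"
      using assms(1) f h(1) conn by (intro connectedin_graph_over_path) auto
    moreover have "h ` {0..1} \<subseteq> topspace X"
      using h(1) by (auto simp: continuous_map_def)
    moreover have "a \<in> h ` {0..1}" "b \<in> h ` {0..1}"
      using h(2,3) by force+
    ultimately show ?thesis
      by (intro exI[of _ "(\<lambda>x. (x, f x)) ` h ` {0..1}"]) (auto simp: connectedin_subtopology)
  qed
  then have "connected_space (subtopology ?P ?\<Gamma>)"
    unfolding connected_space_subconnected by auto
  with \<Gamma> have "connectedin ?P ?\<Gamma>"
    by (simp add: connectedin_def)
  then show ?thesis
    by (simp add: has_connected_graph_def image_def Collect_mem_eq conj_commute Bex_def)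
qed

section \<open>Segments in topological vector spaces\<close>

definition segment_path :: "(real, 'a) module \<Rightarrow> 'a \<Rightarrow> 'a \<Rightarrow> real \<Rightarrow> 'a" where
  "segment_path V a b t = ((1 - t) \<odot>\<^bsub>V\<^esub> a) \<oplus>\<^bsub>V\<^esub> (t \<odot>\<^bsub>V\<^esub> b)"

lemma segment_eq_image: "segment V a b = segment_path V a b ` {0..1}"
  by (auto simp: segment_def segment_path_def)

lemma real_field_simps:
  "carrier real_field = UNIV" "x \<otimes>\<^bsub>real_field\<^esub> y = x * y" "x \<oplus>\<^bsub>real_field\<^esub> y = x + y"
  "\<one>\<^bsub>real_field\<^esub> = 1" "\<zero>\<^bsub>real_field\<^esub> = 0"
  by (simp_all add: real_field_def)

context
  fixes V :: "(real, 'a) module" and a b :: 'a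
  assumes V: "Module.module real_field V" and ab: "a \<in> carrier V" "b \<in> carrier V"
begin

interpretation Module.module real_field V by (rule V)

lemma segment_path_0: "segment_path V a b 0 = a"
  using ab smult_one smult_l_null by (simp add: segment_path_def real_field_simps)

lemma segment_path_1: "segment_path V a b 1 = b"
  using ab smult_one smult_l_null by (simp add: segment_path_def real_field_simps)

lemma segment_path_closed: "segment_path V a b t \<in> carrier V"
  using ab by (simp add: segment_path_def real_field_simps)

text \<open>Collecting the multiples of \<open>a\<close> and of \<open>b\<close> shows that affine
  combinations of points on the line correspond to affine combinations of their parameters.\<close>

lemma segment_path_segment_path:
  "segment_path V (segment_path V a b s) (segment_path V a b t) u =
    segment_path V a b ((1 - u) * s + u * t)"
proof -
  have closed: "r \<odot>\<^bsub>V\<^esub> x \<in> carrier V" if "x \<in> carrier V" for r x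
    using that by (simp add: real_field_simps)
  have dist: "(r + q) \<odot>\<^bsub>V\<^esub> x = r \<odot>\<^bsub>V\<^esub> x \<oplus>\<^bsub>V\<^esub> q \<odot>\<^bsub>V\<^esub> x" if "x \<in> carrier V" for r q x
    using smult_l_distr[of r q x] that by (simp add: real_field_simps)
  have assoc: "r \<odot>\<^bsub>V\<^esub> (q \<odot>\<^bsub>V\<^esub> x) = (r * q) \<odot>\<^bsub>V\<^esub> x" if "x \<in> carrier V" for r q x
    using smult_assoc1[of r q x] that by (simp add: real_field_simps)
  have "segment_path V (segment_path V a b s) (segment_path V a b t) u =
      (((1 - u) * (1 - s)) \<odot>\<^bsub>V\<^esub> a \<oplus>\<^bsub>V\<^esub> ((1 - u) * s) \<odot>\<^bsub>V\<^esub> b) \<oplus>\<^bsub>V\<^esub>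
      ((u * (1 - t)) \<odot>\<^bsub>V\<^esub> a \<oplus>\<^bsub>V\<^esub> (u * t) \<odot>\<^bsub>V\<^esub> b)"
    using ab by (simp add: segment_path_def smult_r_distr real_field_simps closed assoc)
  also have "\<dots> = (((1 - u) * (1 - s)) \<odot>\<^bsub>V\<^esub> a \<oplus>\<^bsub>V\<^esub> (u * (1 - t)) \<odot>\<^bsub>V\<^esub> a) \<oplus>\<^bsub>V\<^esub>
      (((1 - u) * s) \<odot>\<^bsub>V\<^esub> b \<oplus>\<^bsub>V\<^esub> (u * t) \<odot>\<^bsub>V\<^esub> b)"
    using ab closed by (simp add: M.a_ac)
  also have "\<dots> = ((1 - u) * (1 - s) + u * (1 - t)) \<odot>\<^bsub>V\<^esub> a \<oplus>\<^bsub>V\<^esub> ((1 - u) * s + u * t) \<odot>\<^bsub>V\<^esub> b"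
    using ab by (simp add: dist)
  also have "(1 - u) * (1 - s) + u * (1 - t) = 1 - ((1 - u) * s + u * t)"
    by (simp add: algebra_simps)
  finally show ?thesis
    by (simp add: segment_path_def)
qed

text \<open>Segmentary connectedness concerns whole segments, whereas the path criterion asks about
  all parameter subintervals; these trace segments themselves.\<close>

lemma segment_path_image:
  assumes "s \<le> t"
  shows "segment_path V a b ` {s..t} = segment V (segment_path V a b s) (segment_path V a b t)"
proof -
  have "{s..t} = (\<lambda>u. (1 - u) * s + u * t) ` {0..1}"
    using assms closed_segment_eq_real_ivl[of s t] closed_segment_image_interval[of s t] by simp
  then show ?thesis
    by (simp add: segment_eq_image image_comp o_def segment_path_segment_path)
qed

end

lemma continuous_map_segment_path:
  assumes "topological_vector_space X V" "a \<in> topspace X" "b \<in> topspace X"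
  shows "continuous_map euclideanreal X (segment_path V a b)"
proof -
  have add: "continuous_map (prod_topology X X) X (\<lambda>(x, y). x \<oplus>\<^bsub>V\<^esub> y)"
    and scale: "continuous_map (prod_topology euclideanreal X) X (\<lambda>(t, x). t \<odot>\<^bsub>V\<^esub> x)"
    using assms(1) by (auto simp: topological_vector_space_def)
  have smult: "continuous_map euclideanreal X (\<lambda>t. r t \<odot>\<^bsub>V\<^esub> c)"
    if "continuous_map euclideanreal euclideanreal r" "c \<in> topspace X" for r c
  proof -
    have "continuous_map euclideanreal (prod_topology euclideanreal X) (\<lambda>t. (r t, c))"
      using that by (simp add: continuous_map_pairedI)
    from continuous_map_compose[OF this scale] show ?thesis
      by (simp add: o_def)
  qed
  have "continuous_map euclideanreal (prod_topology X X) (\<lambda>t. ((1 - t) \<odot>\<^bsub>V\<^esub> a, t \<odot>\<^bsub>V\<^esub> b))"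
    using assms(2,3) by (intro continuous_map_pairedI smult) (auto intro!: continuous_intros)
  from continuous_map_compose[OF this add] show ?thesis
    by (simp add: o_def segment_path_def[abs_def])
qed

section \<open>The three cases of the theorem\<close>

theorem theorem6p3:
  fixes X :: "'a topology"
    and M :: "'b set" and d :: "'b \<Rightarrow> 'b \<Rightarrow> real"
    and f :: "'a \<Rightarrow> 'b"
  defines "Y \<equiv> Metric_space.mtopology M d"
  assumes "hereditarily_Baire_space X"
    and "Metric_space M d"
    and "f ` topspace X \<subseteq> M"
    and "Baire_one_map X Y f"
    and "(connected_space X \<and> locally_connected_space X \<and> weakly_Gibson_map X Y f) \<or>
         (arcwise_connected_space X \<and> Darboux_map X Y f) \<or>
         (\<exists>V :: (real, 'a) module.
            topological_vector_space X V \<and> segmentary_connected_map V Y f)"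
  shows "has_connected_graph X Y f"
  using assms(6)
proof (elim disjE conjE exE)
  assume "connected_space X" "locally_connected_space X" "weakly_Gibson_map X Y f"
  then show ?thesis
    using assms(2,3,5) unfolding Y_def by (intro weakly_Gibson_Baire_one_connected_graph)
next
  assume arc: "arcwise_connected_space X" and Darboux: "Darboux_map X Y f"
  show ?thesis
    unfolding Y_def
  proof (rule has_connected_graph_if_paths[OF assms(3) assms(5)[unfolded Y_def]])
    fix a b assume ab: "a \<in> topspace X" "b \<in> topspace X"
    obtain h :: "real \<Rightarrow> 'a" where h: "continuous_map (top_of_set {0..1}) X h" "h 0 = a" "h 1 = b"
    \<comment> \<open>Arcs are provided only between distinct points; a constant path covers the
      case of equal ends.\<close>
    proof (cases "a = b")
      case True
      then show ?thesis
        using that[of "\<lambda>_. a"] ab by simp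
    next
      case False
      then show ?thesis
        using that arc ab unfolding arcwise_connected_space_def embedding_map_def
        by (metis continuous_map_in_subtopology homeomorphic_imp_continuous_map)
    qed
    have "connectedin Y (f ` h ` {s..t})" if "0 \<le> s" "s \<le> t" "t \<le> 1" for s t
    proof -
      have "connectedin X (h ` {s..t})"
        using h(1) by (rule connectedin_continuous_map_image)
          (use that in \<open>auto simp: connectedin_subtopology\<close>)
      then show ?thesis
        using Darboux by (simp add: Darboux_map_def)
    qed
    then show "\<exists>h :: real \<Rightarrow> 'a. continuous_map (top_of_set {0..1}) X h \<and> h 0 = a \<and> h 1 = b \<and>
        (\<forall>s t. 0 \<le> s \<and> s \<le> t \<and> t \<le> 1 \<longrightarrow>
          connectedin (Metric_space.mtopology M d) (f ` h ` {s..t}))"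
      using h unfolding Y_def by blast
  qed
next
  fix V :: "(real, 'a) module"
  assume tvs: "topological_vector_space X V" and seg: "segmentary_connected_map V Y f"
  have V: "Module.module real_field V" and carrier: "carrier V = topspace X"
    using tvs by (auto simp: topological_vector_space_def)
  show ?thesis
    unfolding Y_def
  proof (rule has_connected_graph_if_paths[OF assms(3) assms(5)[unfolded Y_def]])
    fix a b assume ab: "a \<in> topspace X" "b \<in> topspace X"
    note ab' = ab[folded carrier]
    \<comment> \<open>The subinterval traces the segment between two points of
      \<open>carrier V\<close>, to which \<open>seg\<close> applies.\<close>
    have "connectedin Y (f ` segment_path V a b ` {s..t})" if "s \<le> t" for s t
      using seg segment_path_closed[OF V ab']
      by (simp add: segment_path_image[OF V ab' that] segmentary_connected_map_def)
    then show "\<exists>h :: real \<Rightarrow> 'a. continuous_map (top_of_set {0..1}) X h \<and> h 0 = a \<and> h 1 = b \<and>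
        (\<forall>s t. 0 \<le> s \<and> s \<le> t \<and> t \<le> 1 \<longrightarrow>
          connectedin (Metric_space.mtopology M d) (f ` h ` {s..t}))"
      using continuous_map_from_subtopology[OF continuous_map_segment_path[OF tvs ab]]
        segment_path_0[OF V ab'] segment_path_1[OF V ab']
      unfolding Y_def by (intro exI[of _ "segment_path V a b"]) auto
  qed
qed

end
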